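(* For any $n\ge 2$ and any $k\in\mathbb{N}$, there exists a polynomial automorphism $f$ of $\mathbb{C}^n$ such that $\#(\mathrm{Fix}(f))=k$, i.e. $f$ has exactly $k$ fixed points.
   Context: A polynomial automorphism of $\mathbb{C}^n$ is a polynomial map $\mathbb{C}^n\to\mathbb{C}^n$ that is bijective with polynomial inverse. $\mathrm{Fix}(f)=\{x\in\mathbb{C}^n : f(x)=x\}$, and $\#$ denotes cardinality. *)

theory Defs
  imports "HOL-Analysis.Analysis"
begin

text \<open>
  Since \<open>\<complex>\<close> is infinite, polynomials in the coordinates are identified with the functions they
  induce. A multi-index is an arbitrary function \<open>m :: 'n \<Rightarrow> nat\<close>; finiteness of the
  polynomial is finiteness of the set \<open>M\<close> of multi-indices being summed over.
\<close>

definition polynomial_fun :: "(complex ^ 'n::finite \<Rightarrow> complex) \<Rightarrow> bool" where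
  "polynomial_fun p \<longleftrightarrow>
     (\<exists>(M :: ('n \<Rightarrow> nat) set) (c :: ('n \<Rightarrow> nat) \<Rightarrow> complex).
        finite M \<and> (\<forall>x. p x = (\<Sum>m\<in>M. c m * (\<Prod>i\<in>UNIV. (x $ i) ^ m i))))"

definition polynomial_map :: "(complex ^ 'n::finite \<Rightarrow> complex ^ 'm::finite) \<Rightarrow> bool" where
  "polynomial_map f \<longleftrightarrow> (\<forall>j. polynomial_fun (\<lambda>x. f x $ j))"

definition polynomial_automorphism :: "(complex ^ 'n::finite \<Rightarrow> complex ^ 'n) \<Rightarrow> bool" where
  "polynomial_automorphism f \<longleftrightarrow> polynomial_map f \<and> bij f \<and> polynomial_map (inv f)"

definition Fix :: "('a \<Rightarrow> 'a) \<Rightarrow> 'a set" where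
  "Fix f = {x. f x = x}"

end

(* With P a polynomial having exactly k roots, the Henon-type map (x, y) |-> (y, 2y - x + P(y)) is
   invertible with polynomial inverse, and its fixed points are the (t, t) with P(t) = 0.  Acting on
   the remaining coordinates by multiplication by 2 creates no further fixed points. *)
theory Submission
  imports Defs "HOL-Computational_Algebra.Polynomial"
begin

lemma polynomial_fun_monomial:
  "polynomial_fun (\<lambda>x :: complex ^ 'n::finite. c * (\<Prod>i\<in>UNIV. (x $ i) ^ m i))"
  unfolding polynomial_fun_def by (rule exI[of _ "{m}"], rule exI[of _ "\<lambda>_. c"]) simp

lemma polynomial_fun_add:
  fixes p q :: "complex ^ 'n::finite \<Rightarrow> complex"
  assumes "polynomial_fun p" "polynomial_fun q"
  shows "polynomial_fun (\<lambda>x. p x + q x)"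
proof -
  obtain M c where M: "finite M" and p: "\<And>x. p x = (\<Sum>m\<in>M. c m * (\<Prod>i\<in>UNIV. (x $ i) ^ m i))"
    using assms(1) unfolding polynomial_fun_def by blast
  obtain N d where N: "finite N" and q: "\<And>x. q x = (\<Sum>m\<in>N. d m * (\<Prod>i\<in>UNIV. (x $ i) ^ m i))"
    using assms(2) unfolding polynomial_fun_def by blast
  \<comment> \<open>\<open>c\<close> and \<open>d\<close> are arbitrary outside \<open>M\<close> and
    \<open>N\<close>, so they are cut off to 0 there. Both sums can then range over
    \<open>M \<union> N\<close>, and coefficients of shared multi-indices add.\<close>
  define e where "e m = (if m \<in> M then c m else 0) + (if m \<in> N then d m else 0)" for m
  have "p x + q x = (\<Sum>m\<in>M \<union> N. e m * (\<Prod>i\<in>UNIV. (x $ i) ^ m i))" for x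
  proof -
    have "p x = (\<Sum>m\<in>M \<union> N. (if m \<in> M then c m else 0) * (\<Prod>i\<in>UNIV. (x $ i) ^ m i))"
      unfolding p by (rule sum.mono_neutral_cong_left) (use M N in auto)
    moreover have "q x = (\<Sum>m\<in>M \<union> N. (if m \<in> N then d m else 0) * (\<Prod>i\<in>UNIV. (x $ i) ^ m i))"
      unfolding q by (rule sum.mono_neutral_cong_left) (use M N in auto)
    ultimately show ?thesis
      by (simp add: e_def distrib_right sum.distrib)
  qed
  with M N show ?thesis
    unfolding polynomial_fun_def by blast
qed

lemma polynomial_fun_sum:
  fixes p :: "'b \<Rightarrow> complex ^ 'n::finite \<Rightarrow> complex"
  assumes "\<And>s. s \<in> S \<Longrightarrow> polynomial_fun (p s)"
  shows "polynomial_fun (\<lambda>x. \<Sum>s\<in>S. p s x)"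
  using assms
proof (induction S rule: infinite_finite_induct)
  case (insert s S)
  then show ?case by (simp add: polynomial_fun_add)
\<comment> \<open>Over an empty or infinite \<open>S\<close> the sum is 0, a monomial with
  coefficient 0.\<close>
qed (use polynomial_fun_monomial[of 0] in auto)

lemma polynomial_fun_poly_nth:
  "polynomial_fun (\<lambda>x :: complex ^ 'n::finite. poly p (x $ j))"
proof -
  have "polynomial_fun (\<lambda>x :: complex ^ 'n. coeff p d * (x $ j) ^ d)" for d
  proof -
    \<comment> \<open>A multi-index supported at \<open>j\<close> alone gives a pure power of that
      coordinate, since all other factors are 0th powers.\<close>
    have "(\<Prod>i\<in>UNIV. (x $ i) ^ (if i = j then d else 0)) = (x $ j) ^ d" for x :: "complex ^ 'n"
      by (simp add: if_distrib[of "power _"] prod.delta cong: if_cong)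
    then show ?thesis
      using polynomial_fun_monomial[of "coeff p d" "\<lambda>i. if i = j then d else 0"] by simp
  qed
  then show ?thesis
    unfolding poly_altdef by (intro polynomial_fun_sum)
qed

lemma polynomial_fun_scaled_nth:
  "polynomial_fun (\<lambda>x :: complex ^ 'n::finite. c * x $ j)"
  using polynomial_fun_poly_nth[of "[:0, c:]" j] by (simp add: mult.commute)

lemma polynomial_automorphismI:
  assumes "polynomial_map f" "polynomial_map g" "\<And>x. g (f x) = x" "\<And>x. f (g x) = x"
  shows "polynomial_automorphism f"
proof -
  have "bij f" using assms(3,4) by (metis bijI')
  moreover have "inv f = g" using assms(3,4) by (intro inv_equality) auto
  ultimately show ?thesis using assms(1,2) by (simp add: polynomial_automorphism_def)
qed

text \<open>The factor \<open>- 1\<close> and the merging of \<open>2 * y\<close> into the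
  polynomial give coordinate \<open>b\<close> the literal shape of a scaled coordinate plus a
  univariate polynomial in a coordinate, which the closure lemmas match.\<close>

definition henon :: "'n \<Rightarrow> 'n \<Rightarrow> complex poly \<Rightarrow> complex ^ 'n::finite \<Rightarrow> complex ^ 'n" where
  "henon a b p x = (\<chi> i. if i = a then x $ b
     else if i = b then - 1 * x $ a + poly ([:0, 2:] + p) (x $ b) else 2 * x $ i)"

text \<open>Solving u = y, v = q(y) - x gives y = u, x = q(u) - v: the same formula with
  \<open>a\<close> and \<open>b\<close> exchanged. The doubled coordinates are halved.\<close>

definition henon_inv :: "'n \<Rightarrow> 'n \<Rightarrow> complex poly \<Rightarrow> complex ^ 'n::finite \<Rightarrow> complex ^ 'n" where
  "henon_inv a b p x = (\<chi> i. if i = b then x $ a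
     else if i = a then - 1 * x $ b + poly ([:0, 2:] + p) (x $ a) else 1 / 2 * x $ i)"

lemma polynomial_automorphism_henon:
  assumes "a \<noteq> b"
  shows "polynomial_automorphism (henon a b p)"
proof (rule polynomial_automorphismI)
  have nth: "polynomial_fun (\<lambda>x :: complex ^ 'a. x $ j)" for j
    using polynomial_fun_scaled_nth[of 1] by simp
  \<comment> \<open>One fact for each kind of coordinate: copied, sheared, scaled. They serve below
    as rewrite rules to \<open>True\<close>, and restricting the simplifier keeps the terms in the
    shape they match.\<close>
  note intros = nth polynomial_fun_add[OF polynomial_fun_scaled_nth polynomial_fun_poly_nth]
    polynomial_fun_scaled_nth
  show "polynomial_map (henon a b p)"
    unfolding polynomial_map_def
  proof
    fix j
    consider "j = a" | "j \<noteq> a" "j = b" | "j \<noteq> a" "j \<noteq> b" by blast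
    then show "polynomial_fun (\<lambda>x. henon a b p x $ j)"
      by cases (simp_all only: henon_def vec_lambda_beta if_True if_False intros simp_thms)
  qed
  show "polynomial_map (henon_inv a b p)"
    unfolding polynomial_map_def
  proof
    fix j
    consider "j = b" | "j \<noteq> b" "j = a" | "j \<noteq> b" "j \<noteq> a" by blast
    then show "polynomial_fun (\<lambda>x. henon_inv a b p x $ j)"
      by cases (simp_all only: henon_inv_def vec_lambda_beta if_True if_False intros simp_thms)
  qed
  show "henon_inv a b p (henon a b p x) = x" "henon a b p (henon_inv a b p x) = x" for x
    using assms by (simp_all add: henon_def henon_inv_def vec_eq_iff)
qed

lemma Fix_henon:
  assumes "a \<noteq> b"
  shows "Fix (henon a b p) = (\<lambda>t. \<chi> i. if i = a \<or> i = b then t else 0) ` {t. poly p t = 0}"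
    (is "_ = ?v ` _")
proof (intro set_eqI iffI)
  fix x assume "x \<in> Fix (henon a b p)"
  then have fixed: "henon a b p x $ i = x $ i" for i by (simp add: Fix_def)
  have ab: "x $ b = x $ a" using fixed[of a] by (simp add: henon_def)
  \<comment> \<open>With both coordinates equal to t, coordinate \<open>b\<close> reads t = 2t - t +
    P(t).\<close>
  have "poly p (x $ a) = 0" using fixed[of b] assms ab by (simp add: henon_def)
  moreover have "x $ i = 0" if "i \<noteq> a" "i \<noteq> b" for i
    using fixed[of i] that by (simp add: henon_def)
  then have "x = ?v (x $ a)" using ab by (auto simp: vec_eq_iff)
  ultimately show "x \<in> ?v ` {t. poly p t = 0}" by blast
next
  fix x assume "x \<in> ?v ` {t. poly p t = 0}"
  then show "x \<in> Fix (henon a b p)" using assms by (auto simp: Fix_def henon_def vec_eq_iff)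
qed

theorem proposition1p5:
  fixes k :: nat
  assumes "CARD('n::finite) \<ge> 2"
  shows "\<exists>f :: complex ^ 'n \<Rightarrow> complex ^ 'n.
           polynomial_automorphism f \<and> finite (Fix f) \<and> card (Fix f) = k"
proof -
  obtain a b :: 'n where ab: "a \<noteq> b"
    using assms ex_card[of 2 "UNIV :: 'n set"] by (auto simp: card_2_iff)
  \<comment> \<open>The roots 0, ..., k - 1 are distinct in characteristic 0. For k = 0 the empty
    product is 1, which has no root.\<close>
  define p :: "complex poly" where "p = (\<Prod>j<k. [:- of_nat j, 1:])"
  define v :: "complex \<Rightarrow> complex ^ 'n" where "v t = (\<chi> i. if i = a \<or> i = b then t else 0)" for t
  have roots: "{t. poly p t = 0} = of_nat ` {..<k}"
    by (auto simp: p_def poly_prod)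
  \<comment> \<open>Coordinate \<open>a\<close> of \<open>v t\<close> recovers t.\<close>
  have inj: "inj v"
    by (rule injI, drule arg_cong[of _ _ "\<lambda>x. x $ a"]) (simp add: v_def)
  have "Fix (henon a b p) = v ` of_nat ` {..<k}"
    using Fix_henon[OF ab, of p] by (simp add: roots v_def)
  moreover have "card (v ` of_nat ` {..<k}) = k"
    using inj by (simp add: card_image inj_on_subset inj_on_def)
  \<comment> \<open>Finiteness holds because the fixed points are an image of \<open>{..<k}\<close>.
    It matters for k = 0, as \<open>card\<close> is also 0 on infinite sets.\<close>
  ultimately show ?thesis
    using polynomial_automorphism_henon[OF ab, of p] by (intro exI[of _ "henon a b p"]) simp
qed

end
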